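(* Let $d\ge 1$, let $\Omega\subset\mathbb{R}^d$ be an arbitrary (bounded or unbounded) domain, and let $f\in L^2(\Omega)$. Let $(u,p)\in \mathring{H}^1(\Omega)\times D(\Omega)$ be the exact solution pair of the reaction-diffusion problem $$-\nabla u+p=0\ \text{ in }\Omega,\qquad -\operatorname{div}p+u=f\ \text{ in }\Omega,$$ and let $(\tilde u,\tilde p)\in \mathring{H}^1(\Omega)\times D(\Omega)$ be an arbitrary (approximation) pair. Then $$\|u-\tilde u\|_{H^1(\Omega)}^2+\|p-\tilde p\|_{D(\Omega)}^2=\|f-\tilde u+\operatorname{div}\tilde p\|_{L^2(\Omega)}^2+\|\tilde p-\nabla\tilde u\|_{L^2(\Omega)}^2 .$$
   Context: All functions and vector fields are real valued; $L^2(\Omega)$ is used for both scalar functions and $\mathbb{R}^d$-valued vector fields; derivatives are weak. $H^1(\Omega)=\{\varphi\in L^2(\Omega): \nabla\varphi\in L^2(\Omega)\}$ with $\|\varphi\|_{H^1(\Omega)}^2=\|\varphi\|_{L^2(\Omega)}^2+\|\nabla\varphi\|_{L^2(\Omega)}^2$. $D(\Omega)=\{\psi\in L^2(\Omega):\operatorname{div}\psi\in L^2(\Omega)\}$ (vector fields) with $\|\psi\|_{D(\Omega)}^2=\|\psi\|_{L^2(\Omega)}^2+\|\operatorname{div}\psi\|_{L^2(\Omega)}^2$. $\mathring{H}^1(\Omega)$ is the closure in $H^1(\Omega)$ of the smooth functions with compact support in $\Omega$. The stated problem has a unique solution $(u,p)\in \mathring{H}^1(\Omega)\times D(\Omega)$.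 *)

theory Defs
  imports "HOL-Analysis.Analysis"
begin

text \<open>
  Elements of the function spaces are represented by functions on the whole space \<open>real ^ 'd\<close>, of
  which only the values in \<open>\<Omega>\<close>, up to Lebesgue null sets, matter; equations in \<open>\<Omega>\<close> are
  therefore equations almost everywhere.
\<close>

definition L2 :: "(real ^ 'd) set \<Rightarrow> (real ^ 'd \<Rightarrow> 'b::euclidean_space) set" where
  "L2 \<Omega> = {f \<in> borel_measurable (lebesgue_on \<Omega>).
             integrable (lebesgue_on \<Omega>) (\<lambda>x. (norm (f x))\<^sup>2)}"

definition L2_norm :: "(real ^ 'd) set \<Rightarrow> (real ^ 'd \<Rightarrow> 'b::euclidean_space) \<Rightarrow> real" where
  "L2_norm \<Omega> f = sqrt (LINT x|lebesgue_on \<Omega>. (norm (f x))\<^sup>2)"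

definition locally_L1 :: "(real ^ 'd) set \<Rightarrow> (real ^ 'd \<Rightarrow> 'b::euclidean_space) set" where
  "locally_L1 \<Omega> = {f. \<forall>K. compact K \<and> K \<subseteq> \<Omega> \<longrightarrow> f absolutely_integrable_on K}"

definition partial_deriv :: "'d \<Rightarrow> (real ^ 'd \<Rightarrow> real) \<Rightarrow> real ^ 'd \<Rightarrow> real" where
  "partial_deriv i \<phi> x = frechet_derivative \<phi> (at x) (axis i 1)"

definition classical_grad :: "(real ^ 'd \<Rightarrow> real) \<Rightarrow> real ^ 'd \<Rightarrow> real ^ 'd" where
  "classical_grad \<phi> x = (\<chi> i. partial_deriv i \<phi> x)"

primrec Ck :: "nat \<Rightarrow> (real ^ 'd \<Rightarrow> real) \<Rightarrow> bool" where
  "Ck 0 \<phi> \<longleftrightarrow> continuous_on UNIV \<phi>"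
| "Ck (Suc k) \<phi> \<longleftrightarrow> (\<forall>x. \<phi> differentiable (at x)) \<and> (\<forall>i. Ck k (partial_deriv i \<phi>))"

text \<open>
  Smooth functions with compact support in \<open>\<Omega>\<close>, extended by zero outside \<open>\<Omega>\<close>.
\<close>

definition test_functions :: "(real ^ 'd) set \<Rightarrow> (real ^ 'd \<Rightarrow> real) set" where
  "test_functions \<Omega> = {\<phi>. (\<forall>k. Ck k \<phi>) \<and>
     compact (closure {x. \<phi> x \<noteq> 0}) \<and> closure {x. \<phi> x \<noteq> 0} \<subseteq> \<Omega>}"

definition has_weak_grad ::
    "(real ^ 'd) set \<Rightarrow> (real ^ 'd \<Rightarrow> real) \<Rightarrow> (real ^ 'd \<Rightarrow> real ^ 'd) \<Rightarrow> bool" where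
  "has_weak_grad \<Omega> u g \<longleftrightarrow> u \<in> locally_L1 \<Omega> \<and> g \<in> locally_L1 \<Omega> \<and>
     (\<forall>\<phi> \<in> test_functions \<Omega>.
        (LINT x|lebesgue_on \<Omega>. u x *\<^sub>R classical_grad \<phi> x) =
        - (LINT x|lebesgue_on \<Omega>. \<phi> x *\<^sub>R g x))"

definition has_weak_div ::
    "(real ^ 'd) set \<Rightarrow> (real ^ 'd \<Rightarrow> real ^ 'd) \<Rightarrow> (real ^ 'd \<Rightarrow> real) \<Rightarrow> bool" where
  "has_weak_div \<Omega> \<psi> q \<longleftrightarrow> \<psi> \<in> locally_L1 \<Omega> \<and> q \<in> locally_L1 \<Omega> \<and>
     (\<forall>\<phi> \<in> test_functions \<Omega>.
        (LINT x|lebesgue_on \<Omega>. \<psi> x \<bullet> classical_grad \<phi> x) =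
        - (LINT x|lebesgue_on \<Omega>. \<phi> x * q x))"

text \<open>
  Weak derivatives on an open set are unique up to a null set, so the choice below only selects a
  representative.
\<close>

definition weak_grad :: "(real ^ 'd) set \<Rightarrow> (real ^ 'd \<Rightarrow> real) \<Rightarrow> real ^ 'd \<Rightarrow> real ^ 'd" where
  "weak_grad \<Omega> u = (SOME g. has_weak_grad \<Omega> u g)"

definition weak_div :: "(real ^ 'd) set \<Rightarrow> (real ^ 'd \<Rightarrow> real ^ 'd) \<Rightarrow> real ^ 'd \<Rightarrow> real" where
  "weak_div \<Omega> \<psi> = (SOME q. has_weak_div \<Omega> \<psi> q)"

definition H1 :: "(real ^ 'd) set \<Rightarrow> (real ^ 'd \<Rightarrow> real) set" where
  "H1 \<Omega> = {u \<in> L2 \<Omega>. \<exists>g \<in> L2 \<Omega>. has_weak_grad \<Omega> u g}"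

definition H1_norm :: "(real ^ 'd) set \<Rightarrow> (real ^ 'd \<Rightarrow> real) \<Rightarrow> real" where
  "H1_norm \<Omega> u = sqrt ((L2_norm \<Omega> u)\<^sup>2 + (L2_norm \<Omega> (weak_grad \<Omega> u))\<^sup>2)"

definition D :: "(real ^ 'd) set \<Rightarrow> (real ^ 'd \<Rightarrow> real ^ 'd) set" where
  "D \<Omega> = {\<psi> \<in> L2 \<Omega>. \<exists>q \<in> L2 \<Omega>. has_weak_div \<Omega> \<psi> q}"

definition D_norm :: "(real ^ 'd) set \<Rightarrow> (real ^ 'd \<Rightarrow> real ^ 'd) \<Rightarrow> real" where
  "D_norm \<Omega> \<psi> = sqrt ((L2_norm \<Omega> \<psi>)\<^sup>2 + (L2_norm \<Omega> (weak_div \<Omega> \<psi>))\<^sup>2)"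

text \<open>The closure of the test functions in \<open>H1 \<Omega>\<close> with respect to \<open>H1_norm \<Omega>\<close>.\<close>

definition H1_0 :: "(real ^ 'd) set \<Rightarrow> (real ^ 'd \<Rightarrow> real) set" where
  "H1_0 \<Omega> = {u \<in> H1 \<Omega>. \<forall>\<epsilon>>0. \<exists>\<phi> \<in> test_functions \<Omega>. H1_norm \<Omega> (\<lambda>x. u x - \<phi> x) < \<epsilon>}"

definition reaction_diffusion ::
    "(real ^ 'd) set \<Rightarrow> (real ^ 'd \<Rightarrow> real) \<Rightarrow> (real ^ 'd \<Rightarrow> real) \<Rightarrow> (real ^ 'd \<Rightarrow> real ^ 'd) \<Rightarrow> bool"
  where
  "reaction_diffusion \<Omega> f u p \<longleftrightarrow>
     (AE x in lebesgue_on \<Omega>. - weak_grad \<Omega> u x + p x = 0) \<and>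
     (AE x in lebesgue_on \<Omega>. - weak_div \<Omega> p x + u x = f x)"

end

theory Submission
  imports Defs
begin

text \<open>
  Write \<open>e = u - u'\<close> and \<open>q = p - p'\<close>. The exact pair satisfies \<open>p = \<nabla>u\<close> and \<open>f = u - div p\<close>, so the
  two residuals on the right-hand side are residuals of the error,
  \<open>f - u' + div p' = e - div q\<close> and \<open>p' - \<nabla>u' = \<nabla>e - q\<close>. Expanding the two squares produces the
  four squares of the left-hand side and the cross term \<open>-2 \<integral> (e div q + \<nabla>e \<bullet> q)\<close>. This term is
  the integral of the divergence of \<open>e q\<close>, and it vanishes because \<open>e\<close> has zero boundary values
  (\<open>green_form_H1_0_eq_0\<close>): for a test function \<open>e\<close> it vanishes by the definition of the weak
  divergence, and the form is continuous in \<open>e\<close> with respect to the \<open>H1\<close> norm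
  (\<open>abs_green_form_le\<close>), so that it vanishes on the closure.

  To compute with \<open>weak_grad\<close> and \<open>weak_div\<close>, which are chosen representatives, two facts on weak
  derivatives have to be established. The first is uniqueness up to null sets
  (\<open>weak_derivative_unique\<close>); it makes the chosen representatives square integrable and linear almost
  everywhere. It rests on the fundamental lemma of the calculus of variations, for which products of
  one-dimensional functions \<open>exp (- 1 / t)\<close> provide test functions that approximate the indicator
  functions of boxes. The second is that the classical gradient of a test function is its weak
  gradient (\<open>has_weak_grad_test_function\<close>), without which the \<open>H1\<close> distance from a test function
  could not be split. This is integration by parts, and it holds because the integral of a partial
  derivative of a compactly supported function is the limit of integrals of difference quotients,
  which are zero by translation invariance.
\<close>

section \<open>Calculus of smooth functions\<close>

lemma partial_deriv_eq:
  assumes "(f has_derivative f') (at x)"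
  shows "partial_deriv i f x = f' (axis i 1)"
  unfolding partial_deriv_def using frechet_derivative_at[OF assms] by simp

lemma Ck_Suc_imp: "Ck (Suc k) f \<Longrightarrow> Ck k f"
proof (induction k arbitrary: f)
  case 0
  then show ?case
    by (auto intro: differentiable_imp_continuous_on simp: differentiable_on_def differentiable_at_withinI)
next
  case (Suc k)
  then show ?case by (auto simp del: Ck.simps(1))
qed

lemma Ck_imp_continuous_on: "Ck k f \<Longrightarrow> continuous_on UNIV f"
  by (induction k) (use Ck_Suc_imp in auto)

lemma Ck_const: "Ck k (\<lambda>x. c)"
proof (induction k arbitrary: c)
  case (Suc k)
  have "partial_deriv i (\<lambda>x. c) = (\<lambda>x. 0)" for i :: 'a
    by (rule ext, subst partial_deriv_eq[OF has_derivative_const]) simp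
  then show ?case using Suc by auto
qed auto

lemma partial_deriv_add:
  assumes "f differentiable (at x)" "g differentiable (at x)"
  shows "partial_deriv i (\<lambda>x. f x + g x) x = partial_deriv i f x + partial_deriv i g x"
  using partial_deriv_eq[OF has_derivative_add[OF assms[unfolded frechet_derivative_works]]]
  by (simp add: partial_deriv_def)

lemma partial_deriv_mult:
  assumes "f differentiable (at x)" "g differentiable (at x)"
  shows "partial_deriv i (\<lambda>x. f x * g x) x = f x * partial_deriv i g x + partial_deriv i f x * g x"
  using partial_deriv_eq[OF has_derivative_mult[OF assms[unfolded frechet_derivative_works]]]
  by (simp add: partial_deriv_def)

lemma Ck_add: "Ck k f \<Longrightarrow> Ck k g \<Longrightarrow> Ck k (\<lambda>x. f x + g x)"
proof (induction k arbitrary: f g)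
  case (Suc k)
  then have "partial_deriv i (\<lambda>x. f x + g x) = (\<lambda>x. partial_deriv i f x + partial_deriv i g x)" for i
    by (intro ext partial_deriv_add) auto
  then show ?case using Suc by auto
qed (auto intro: continuous_intros)

lemma Ck_mult: "Ck k f \<Longrightarrow> Ck k g \<Longrightarrow> Ck k (\<lambda>x. f x * g x)"
proof (induction k arbitrary: f g)
  case (Suc k)
  then have "partial_deriv i (\<lambda>x. f x * g x)
      = (\<lambda>x. f x * partial_deriv i g x + partial_deriv i f x * g x)" for i
    by (intro ext partial_deriv_mult) auto
  moreover have "Ck k f" "Ck k g" using Suc.prems Ck_Suc_imp by blast+
  ultimately show ?case using Suc by (auto intro!: Ck_add)
qed (auto intro: continuous_intros)

lemma Ck_prod: "finite I \<Longrightarrow> (\<And>i. i \<in> I \<Longrightarrow> Ck k (f i)) \<Longrightarrow> Ck k (\<lambda>x. \<Prod>i\<in>I. f i x)"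
  by (induction I rule: finite_induct) (auto intro: Ck_const Ck_mult)

section \<open>Test functions approximating the indicator of a box\<close>

text \<open>
  For \<open>t > 0\<close> and up to the factor \<open>exp (- 1 / t)\<close>, these are the powers of \<open>1 / t\<close>. The family is closed under
  differentiation up to linear combinations, which is what makes \<open>flat 0\<close> smooth.
\<close>

definition flat :: "nat \<Rightarrow> real \<Rightarrow> real" where
  "flat m t = (if t \<le> 0 then 0 else inverse t ^ m / exp (inverse t))"

text \<open>
  At the origin the exponential beats every power of \<open>1 / t\<close>.
\<close>

lemma flat_has_derivative_0: "(flat m has_real_derivative 0) (at 0)"
proof -
  have "((\<lambda>t. flat m t / t) \<longlongrightarrow> 0) (at_right 0)"
  proof (rule Lim_transform_eventually)
    show "((\<lambda>t::real. inverse t ^ Suc m / exp (inverse t)) \<longlongrightarrow> 0) (at_right 0)"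
      by (rule filterlim_compose[OF tendsto_power_div_exp_0 filterlim_inverse_at_top_right])
    show "\<forall>\<^sub>F t in at_right 0. inverse t ^ Suc m / exp (inverse t) = flat m t / t"
      by (rule eventually_at_rightI[of 0 1]) (auto simp: flat_def field_simps)
  qed
  moreover have "((\<lambda>t. flat m t / t) \<longlongrightarrow> 0) (at_left 0)"
    by (rule tendsto_eventually, rule eventually_at_leftI[of "-1" 0]) (auto simp: flat_def)
  ultimately show ?thesis
    unfolding has_field_derivative_iff by (simp add: filterlim_split_at flat_def)
qed

lemma flat_has_derivative:
  "(flat m has_real_derivative flat (Suc (Suc m)) t - real m * flat (Suc m) t) (at t)"
proof (cases t "0::real" rule: linorder_cases)
  case less
  have "((\<lambda>t. 0) has_real_derivative 0) (at t)" by simp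
  then have "(flat m has_real_derivative 0) (at t)"
    by (rule has_field_derivative_transform_within_open[where S="{..<0}"])
      (use less in \<open>auto simp: flat_def\<close>)
  then show ?thesis using less by (simp add: flat_def)
next
  case equal
  then show ?thesis using flat_has_derivative_0[of m] by (simp add: flat_def)
next
  case greater
  have "((\<lambda>t. inverse t ^ m * exp (- inverse t)) has_real_derivative
      real m * (inverse t ^ (m - 1) * - (inverse t * inverse t)) * exp (- inverse t)
      + inverse t ^ m * (exp (- inverse t) * (inverse t * inverse t))) (at t)"
    using greater by (auto intro!: derivative_eq_intros simp: power2_eq_square)
  also have "real m * (inverse t ^ (m - 1) * - (inverse t * inverse t)) * exp (- inverse t)
      + inverse t ^ m * (exp (- inverse t) * (inverse t * inverse t))
      = flat (Suc (Suc m)) t - real m * flat (Suc m) t"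
    using greater by (cases m) (simp_all add: flat_def exp_minus divide_inverse algebra_simps)
  finally have "((\<lambda>t. inverse t ^ m * exp (- inverse t)) has_real_derivative
      flat (Suc (Suc m)) t - real m * flat (Suc m) t) (at t)" .
  then show ?thesis
    by (rule has_field_derivative_transform_within_open[where S="{0<..}"])
      (use greater in \<open>auto simp: flat_def exp_minus field_simps\<close>)
qed

text \<open>
  A derivative of \<open>flat m\<close> is a linear combination of later members of the family, so an induction
  over the order of differentiation works once \<open>m\<close> is arbitrary. The affine argument covers both
  kinds of factors of \<open>bump\<close>.
\<close>

lemma Ck_flat: "Ck k (\<lambda>x::real^'d. flat m (c * x $ i + e))"
proof (induction k arbitrary: m)
  case 0
  have "continuous_on UNIV (flat m)"
    using flat_has_derivative DERIV_isCont by (metis continuous_at_imp_continuous_on)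
  then show ?case
    by (auto intro!: continuous_intros continuous_on_compose2[of UNIV "flat m"])
next
  case (Suc k)
  have D: "((\<lambda>x::real^'d. flat m (c * x $ i + e)) has_derivative
     (\<lambda>h. (flat (Suc (Suc m)) (c * x $ i + e) - real m * flat (Suc m) (c * x $ i + e)) * (c * h $ i))) (at x)" for x
    by (rule has_derivative_compose[OF _ flat_has_derivative[unfolded has_field_derivative_def]])
      (auto intro!: derivative_eq_intros bounded_linear_imp_has_derivative)
  have eq: "partial_deriv j (\<lambda>x::real^'d. flat m (c * x $ i + e)) = (\<lambda>x.
     (c * axis j 1 $ i) * flat (Suc (Suc m)) (c * x $ i + e)
     + (- (c * axis j 1 $ i) * real m) * flat (Suc m) (c * x $ i + e))" for j
    by (rule ext, subst partial_deriv_eq[OF D]) (simp add: algebra_simps)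
  have "Ck k (partial_deriv j (\<lambda>x::real^'d. flat m (c * x $ i + e)))" for j
    unfolding eq by (intro Ck_add Ck_mult Ck_const Suc.IH)
  then show ?case
    using D by (auto simp: differentiable_def)
qed

text \<open>
  For \<open>n > 0\<close>, since \<open>flat 0 (n s) = (flat 0 s) powr (1 / n)\<close>, increasing \<open>n\<close> takes roots of one fixed function that
  is positive exactly on the box; the roots stay smooth and tend to the indicator of the box.
\<close>

definition bump :: "nat \<Rightarrow> real ^ 'd \<Rightarrow> real ^ 'd \<Rightarrow> real ^ 'd \<Rightarrow> real" where
  "bump n a b x = (\<Prod>i\<in>UNIV. flat 0 (real n * (x $ i - a $ i)) * flat 0 (real n * (b $ i - x $ i)))"

lemma bump_nonzero_iff: "bump (Suc n) a b x \<noteq> 0 \<longleftrightarrow> x \<in> box a b"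
proof -
  have "flat 0 (real (Suc n) * s) = 0 \<longleftrightarrow> s \<le> 0" for s
    by (auto simp: flat_def mult_le_0_iff)
  then show ?thesis by (auto simp: bump_def mem_box_cart not_le simp del: of_nat_Suc)
qed

lemma Ck_bump: "Ck k (bump n a b)"
proof -
  have "Ck k (\<lambda>x. flat 0 (real n * (x $ i - a $ i)))" for i
    using Ck_flat[of k 0 "real n" i "- real n * a $ i"] by (simp add: algebra_simps)
  moreover have "Ck k (\<lambda>x. flat 0 (real n * (b $ i - x $ i)))" for i
    using Ck_flat[of k 0 "- real n" i "real n * b $ i"] by (simp add: algebra_simps)
  ultimately show ?thesis
    unfolding bump_def[abs_def] by (intro Ck_prod Ck_mult) auto
qed

lemma bump_in_test_functions:
  assumes "cbox a b \<subseteq> \<Omega>"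
  shows "bump (Suc n) a b \<in> test_functions \<Omega>"
proof -
  have "closure {x. bump (Suc n) a b x \<noteq> 0} \<subseteq> cbox a b"
    unfolding bump_nonzero_iff using box_subset_cbox by (intro closure_minimal) (auto simp: closed_cbox)
  moreover from this have "compact (closure {x. bump (Suc n) a b x \<noteq> 0})"
    by (meson bounded_cbox bounded_subset closed_closure compact_eq_bounded_closed)
  ultimately show ?thesis
    using assms Ck_bump unfolding test_functions_def by auto
qed

lemma flat_0_le_1: "\<bar>flat 0 t\<bar> \<le> 1"
  by (auto simp: flat_def)

lemma abs_bump_le_1: "\<bar>bump n a b x\<bar> \<le> 1"
  unfolding bump_def abs_prod
  by (rule prod_le_1) (auto simp: abs_mult intro!: mult_le_one flat_0_le_1)

lemma bump_tendsto_indicator: "(\<lambda>n. bump (Suc n) a b x) \<longlonglongrightarrow> indicator (box a b) x"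
proof (cases "x \<in> box a b")
  case True
  have *: "(\<lambda>n. flat 0 (real (Suc n) * s)) \<longlonglongrightarrow> 1" if "s > 0" for s
  proof -
    have "(\<lambda>n. 1 / exp (inverse (real (Suc n)) * inverse s)) \<longlonglongrightarrow> 1 / exp (0 * inverse s)"
      by (intro tendsto_intros LIMSEQ_inverse_real_of_nat) auto
    then show ?thesis using that by (simp add: flat_def mult_le_0_iff)
  qed
  have "(\<lambda>n. bump (Suc n) a b x) \<longlonglongrightarrow> (\<Prod>i\<in>(UNIV::'a set). 1 * 1)"
    unfolding bump_def by (intro tendsto_prod tendsto_mult *) (use True in \<open>auto simp: mem_box_cart\<close>)
  then show ?thesis using True by simp
next
  case False
  then show ?thesis using bump_nonzero_iff[of _ a b x] by simp
qed

section \<open>Test functions and their products with locally integrable functions\<close>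

lemma partial_deriv_eq_0_outside:
  assumes "closed K" "\<And>x. x \<notin> K \<Longrightarrow> f x = 0" "x \<notin> K"
  shows "partial_deriv i f x = 0"
proof -
  have "((\<lambda>x. 0::real) has_derivative (\<lambda>h. 0)) (at x)" by simp
  then have "(f has_derivative (\<lambda>h. 0)) (at x)"
    by (rule has_derivative_transform_within_open[where s="- K"]) (use assms in \<open>auto simp: open_Compl\<close>)
  from partial_deriv_eq[OF this] show ?thesis by simp
qed

lemma test_function_continuous:
  assumes "\<phi> \<in> test_functions \<Omega>"
  shows "continuous_on UNIV \<phi>"
proof -
  have "Ck 0 \<phi>" using assms by (simp add: test_functions_def del: Ck.simps)
  then show ?thesis by simp
qed

lemma test_function_differentiable:
  assumes "\<phi> \<in> test_functions \<Omega>"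
  shows "\<phi> differentiable (at x)"
proof -
  have "Ck (Suc 0) \<phi>" using assms unfolding test_functions_def by blast
  then show ?thesis by simp
qed

text \<open>
  Differentiation does not enlarge the support.
\<close>

lemma test_function_partial_deriv:
  assumes "\<phi> \<in> test_functions \<Omega>"
  shows "partial_deriv i \<phi> \<in> test_functions \<Omega>"
proof -
  let ?K = "closure {x. \<phi> x \<noteq> 0}"
  have 0: "partial_deriv i \<phi> x = 0" if "x \<notin> ?K" for x
    by (rule partial_deriv_eq_0_outside[OF closed_closure _ that])
      (use closure_subset[of "{x. \<phi> x \<noteq> 0}"] in auto)
  then have sub: "closure {x. partial_deriv i \<phi> x \<noteq> 0} \<subseteq> ?K"
    by (intro closure_minimal) auto
  have K: "compact ?K" "?K \<subseteq> \<Omega>" using assms by (auto simp: test_functions_def)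
  have "compact (closure {x. partial_deriv i \<phi> x \<noteq> 0})"
    using compact_Int_closed[OF K(1) closed_closure] sub by (metis inf.absorb2)
  moreover have "Ck k (partial_deriv i \<phi>)" for k
  proof -
    have "Ck (Suc k) \<phi>" using assms unfolding test_functions_def by blast
    then show ?thesis by simp
  qed
  ultimately show ?thesis
    using sub K(2) unfolding test_functions_def by blast
qed

lemma test_function_support:
  assumes "\<phi> \<in> test_functions \<Omega>"
  obtains K where "compact K" "K \<subseteq> \<Omega>" "\<And>x. x \<notin> K \<Longrightarrow> \<phi> x = 0" "\<And>x. x \<notin> K \<Longrightarrow> classical_grad \<phi> x = 0"
proof
  let ?K = "closure {x. \<phi> x \<noteq> 0}"
  show "compact ?K" "?K \<subseteq> \<Omega>" using assms by (auto simp: test_functions_def)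
  show 0: "\<phi> x = 0" if "x \<notin> ?K" for x
    using that closure_subset[of "{x. \<phi> x \<noteq> 0}"] by auto
  show "classical_grad \<phi> x = 0" if "x \<notin> ?K" for x
    using partial_deriv_eq_0_outside[OF closed_closure 0 that] by (simp add: classical_grad_def vec_eq_iff)
qed

lemma continuous_classical_grad:
  assumes "\<phi> \<in> test_functions \<Omega>"
  shows "continuous_on UNIV (classical_grad \<phi>)"
  unfolding classical_grad_def
  by (intro continuous_on_vec_lambda) (rule test_function_continuous[OF test_function_partial_deriv[OF assms]])

lemma continuous_imp_borel_measurable_lebesgue:
  fixes f :: "'a::euclidean_space \<Rightarrow> 'b::topological_space"
  shows "continuous_on UNIV f \<Longrightarrow> f \<in> borel_measurable lebesgue"
  using continuous_imp_measurable_on_sets_lebesgue[of UNIV f] by (simp add: lebesgue_on_UNIV_eq)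

text \<open>
  On the compact set \<open>K\<close> a locally integrable function is integrable and \<open>c\<close> is bounded. The
  bilinear map stands for the two products in the definitions of weak derivatives, scalar
  multiplication and inner product.
\<close>

lemma integrable_bilinear_compact_support:
  fixes h :: "'b::euclidean_space \<Rightarrow> 'c::euclidean_space \<Rightarrow> 'e::euclidean_space" and g :: "real ^ 'd \<Rightarrow> 'b"
  assumes h: "bilinear h" and g: "g \<in> locally_L1 \<Omega>"
    and K: "compact K" "K \<subseteq> \<Omega>" and \<Omega>: "open \<Omega>"
    and c: "continuous_on UNIV c" "\<And>x. x \<notin> K \<Longrightarrow> c x = 0"
  shows "integrable (lebesgue_on \<Omega>) (\<lambda>x. h (g x) (c x))"
proof -
  have Ksets: "K \<in> sets lebesgue" using K by (simp add: borel_compact sets_completionI_sets)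
  have h': "bilinear (\<lambda>x y. h y x)" using h by (auto simp: bilinear_def)
  have "(\<lambda>x. h (g x) (c x)) absolutely_integrable_on K"
  proof (rule absolutely_integrable_bounded_measurable_product[OF h'])
    show "c \<in> borel_measurable (lebesgue_on K)"
      by (rule continuous_imp_measurable_on_sets_lebesgue[OF _ Ksets]) (use c continuous_on_subset in blast)
    show "bounded (c ` K)"
      by (meson c(1) compact_continuous_image compact_imp_bounded continuous_on_subset K(1) subset_UNIV)
  qed (use g K Ksets in \<open>auto simp: locally_L1_def\<close>)
  then have "integrable lebesgue (\<lambda>x. indicator K x *\<^sub>R h (g x) (c x))"
    by (simp add: set_integrable_def)
  also have "(\<lambda>x. indicator K x *\<^sub>R h (g x) (c x)) = (\<lambda>x. indicator \<Omega> x *\<^sub>R h (g x) (c x))"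
    using K c(2) bilinear_rzero[OF h] by (metis indicator_simps scaleR_zero_right subset_iff)
  finally show ?thesis
    by (subst integrable_restrict_space) (use \<Omega> in \<open>auto simp: sets_completionI_sets\<close>)
qed

lemma bilinear_scaleR: "bilinear (scaleR :: real \<Rightarrow> 'b::euclidean_space \<Rightarrow> 'b)"
  by (auto simp: bilinear_def intro!: linearI simp: algebra_simps)

lemma bilinear_inner: "bilinear (inner :: 'b::euclidean_space \<Rightarrow> 'b \<Rightarrow> real)"
  by (auto simp: bilinear_def intro!: linearI simp: algebra_simps inner_add_left inner_add_right)

lemma integrable_times_test_function:
  assumes "open \<Omega>" "b \<in> locally_L1 \<Omega>" "\<phi> \<in> test_functions \<Omega>"
  shows "integrable (lebesgue_on \<Omega>) (\<lambda>x. \<phi> x *\<^sub>R (b x :: 'b::euclidean_space))"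
proof -
  obtain K where K: "compact K" "K \<subseteq> \<Omega>" "\<And>x. x \<notin> K \<Longrightarrow> \<phi> x = 0"
    using test_function_support[OF assms(3)] by metis
  have "bilinear (\<lambda>(v::'b) (r::real). r *\<^sub>R v)"
    by (auto simp: bilinear_def intro!: linearI simp: algebra_simps)
  from integrable_bilinear_compact_support[OF this assms(2) K(1,2) assms(1) test_function_continuous[OF assms(3)] K(3)]
  show ?thesis .
qed

lemma integrable_times_grad_test_function:
  fixes h :: "'b::euclidean_space \<Rightarrow> real ^ 'd \<Rightarrow> 'c::euclidean_space"
  assumes "bilinear h" "open \<Omega>" "a \<in> locally_L1 \<Omega>" "\<phi> \<in> test_functions \<Omega>"
  shows "integrable (lebesgue_on \<Omega>) (\<lambda>x. h (a x) (classical_grad \<phi> x))"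
proof -
  obtain K where K: "compact K" "K \<subseteq> \<Omega>" "\<And>x. x \<notin> K \<Longrightarrow> classical_grad \<phi> x = 0"
    using test_function_support[OF assms(4)] by metis
  from integrable_bilinear_compact_support[OF assms(1,3) K(1,2) assms(2) continuous_classical_grad[OF assms(4)] K(3)]
  show ?thesis .
qed

section \<open>The fundamental lemma of the calculus of variations\<close>

text \<open>
  Boxes are stable under intersection and generate the Borel sets, and the sets on which the integral
  vanishes form a Dynkin system because \<open>g\<close> is integrable on the surrounding box.
\<close>

lemma integral_box_imp_integral_borel_eq_0:
  fixes g :: "'a::euclidean_space \<Rightarrow> real"
  assumes int: "set_integrable lebesgue (box c d) g"
    and box: "\<And>a b. box a b \<subseteq> box c d \<Longrightarrow> (LINT x:box a b|lebesgue. g x) = 0"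
    and A: "A \<in> sets borel"
  shows "(LINT x:A \<inter> box c d|lebesgue. g x) = 0"
proof -
  have stable: "Int_stable (range (\<lambda>(a, b). box a b :: 'a set))"
    by (auto simp: Int_stable_def box_Int_box)
  have sub: "range (\<lambda>(a, b). box a b :: 'a set) \<subseteq> Pow UNIV" by simp
  have sigma: "sigma_sets UNIV (range (\<lambda>(a, b). box a b :: 'a set)) = sets borel"
    by (simp add: borel_eq_box)
  then have "A \<in> sigma_sets UNIV (range (\<lambda>(a, b). box a b))"
    using A by simp
  with stable sub show ?thesis
  proof (induction A rule: sigma_sets_induct_disjoint)
    case (basic A)
    then obtain a b where "A \<inter> box c d = box a b"
      by (auto simp: box_Int_box)
    then show ?case using box by auto
  next
    case empty
    then show ?case by (simp add: set_lebesgue_integral_def)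
  next
    case (compl A)
    have A: "A \<in> sets lebesgue"
      using compl(1) unfolding sigma by (simp add: sets_completionI_sets)
    have i: "set_integrable lebesgue (A \<inter> box c d) g" "set_integrable lebesgue ((UNIV - A) \<inter> box c d) g"
      using A by (auto intro!: set_integrable_subset[OF int] sets.Int sets.Diff)
    have "(LINT x:box c d|lebesgue. g x)
        = (LINT x:A \<inter> box c d|lebesgue. g x) + (LINT x:(UNIV - A) \<inter> box c d|lebesgue. g x)"
      using set_integral_Un[OF _ i] by (simp add: Int_Un_distrib2[symmetric] Diff_eq Int_left_commute Int_assoc)
    then show ?case using compl(2) box[of c d] by simp
  next
    case (union A)
    have A: "A i \<in> sets lebesgue" for i
      using union(2) unfolding sigma by (auto simp: sets_completionI_sets)
    have eq: "(\<Union>i. A i) \<inter> box c d = (\<Union>i. A i \<inter> box c d)" by auto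
    have "(LINT x:(\<Union>i. A i \<inter> box c d)|lebesgue. g x) = (\<Sum>i. (LINT x:A i \<inter> box c d|lebesgue. g x))"
    proof (rule lebesgue_integral_countable_add)
      show "set_integrable lebesgue (\<Union>i. A i \<inter> box c d) g"
        by (rule set_integrable_subset[OF int]) (use A in auto)
    qed (use A union(1) in \<open>auto simp: disjoint_family_on_def\<close>)
    then show ?case unfolding eq union(3) by simp
  qed
qed

text \<open>
  A Lebesgue set differs from a Borel set by a null set, so the integral of \<open>g\<close> vanishes over all
  Lebesgue measurable subsets of the box, and this determines an integrable function.
\<close>

lemma integral_box_eq_0_imp_AE_eq_0:
  fixes g :: "'a::euclidean_space \<Rightarrow> real"
  assumes int: "set_integrable lebesgue (box c d) g"
    and box: "\<And>a b. box a b \<subseteq> box c d \<Longrightarrow> (LINT x:box a b|lebesgue. g x) = 0"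
  shows "AE x in lebesgue. x \<in> box c d \<longrightarrow> g x = 0"
proof -
  define G where "G x = indicator (box c d) x *\<^sub>R g x" for x
  have G: "integrable lebesgue G"
    using int by (simp add: G_def[abs_def] set_integrable_def)
  have "AE x in lebesgue. G x = 0"
  proof (rule density_unique_real[OF G integrable_zero])
    fix A :: "'a set" assume A: "A \<in> sets lebesgue"
    then obtain S N N' where S: "A = S \<union> N" "N \<subseteq> N'" "N' \<in> null_sets lborel" "S \<in> sets lborel"
      by (rule sets_completionE)
    have "(LINT x:A|lebesgue. G x) = (LINT x:S|lebesgue. G x)"
    proof (rule set_integral_null_delta[OF G A])
      show S': "S \<in> sets lebesgue" using S by (simp add: sets_completionI_sets)
      have "N' \<in> null_sets lebesgue" using S by (simp add: null_sets_completionI)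
      then show "A - S \<union> (S - A) \<in> null_sets lebesgue"
        by (rule null_sets_subset) (use S(1,2) S' A in \<open>blast intro: sets.Diff sets.Un\<close>, use S(1,2) in auto)
    qed
    also have "\<dots> = (LINT x:S \<inter> box c d|lebesgue. g x)"
      unfolding set_lebesgue_integral_def G_def
      by (intro Bochner_Integration.integral_cong) (auto simp: indicator_def)
    also have "\<dots> = 0"
      by (rule integral_box_imp_integral_borel_eq_0[OF int box]) (use S in auto)
    finally show "(LINT x:A|lebesgue. G x) = (LINT x:A|lebesgue. 0)" by simp
  qed
  then show ?thesis by eventually_elim (auto simp: G_def indicator_def)
qed

text \<open>
  Testing with \<open>bump (Suc n) a b\<close> and letting \<open>n\<close> tend to infinity gives a vanishing integral over
  every box whose closure lies in \<open>\<Omega>\<close>; countably many closed boxes cover \<open>\<Omega>\<close>.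
\<close>

lemma fundamental_lemma_calculus_of_variations_real:
  fixes g :: "real ^ 'd \<Rightarrow> real"
  assumes \<Omega>: "open \<Omega>" and g: "g \<in> locally_L1 \<Omega>"
    and 0: "\<And>\<phi>. \<phi> \<in> test_functions \<Omega> \<Longrightarrow> (LINT x|lebesgue_on \<Omega>. \<phi> x * g x) = 0"
  shows "AE x in lebesgue_on \<Omega>. g x = 0"
proof -
  have sets\<Omega>: "\<Omega> \<in> sets lebesgue" using \<Omega> by (simp add: sets_completionI_sets)
  have box0: "(LINT x:box a b|lebesgue. g x) = 0" if ab: "cbox a b \<subseteq> \<Omega>" for a b
  proof -
    define G where "G x = indicator (cbox a b) x *\<^sub>R g x" for x
    have G: "integrable lebesgue G"
      using g ab by (auto simp: G_def[abs_def] locally_L1_def set_integrable_def)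
    have [measurable]: "G \<in> borel_measurable lebesgue" using G by auto
    have [measurable]: "bump n a b \<in> borel_measurable lebesgue" for n
      by (rule continuous_imp_borel_measurable_lebesgue[OF Ck_imp_continuous_on[OF Ck_bump[of 0]]])
    \<comment> \<open>The bumps are bounded by 1, so \<open>G\<close> itself dominates the sequence.\<close>
    have "(\<lambda>n. LINT x|lebesgue. bump (Suc n) a b x * G x)
        \<longlonglongrightarrow> (LINT x|lebesgue. indicator (box a b) x * G x)"
    proof (rule integral_dominated_convergence[where w="\<lambda>x. norm (G x)"])
      show "AE x in lebesgue. (\<lambda>n. bump (Suc n) a b x * G x) \<longlonglongrightarrow> indicator (box a b) x * G x"
        by (intro AE_I2 tendsto_mult_right bump_tendsto_indicator)
      show "AE x in lebesgue. norm (bump (Suc n) a b x * G x) \<le> norm (G x)" for n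
        unfolding norm_mult using abs_bump_le_1[of "Suc n" a b]
        by (intro AE_I2 mult_left_le_one_le) auto
    qed (use G in \<open>auto intro!: borel_measurable_times borel_measurable_indicator\<close>)
    moreover have "(LINT x|lebesgue. bump (Suc n) a b x * G x) = 0" for n
    proof -
      have "(LINT x|lebesgue. bump (Suc n) a b x * G x)
          = (LINT x|lebesgue. indicator \<Omega> x *\<^sub>R (bump (Suc n) a b x * g x))"
        using ab bump_nonzero_iff[of n a b] box_subset_cbox[of a b]
        by (intro Bochner_Integration.integral_cong refl) (auto simp: G_def indicator_def)
      also have "\<dots> = (LINT x|lebesgue_on \<Omega>. bump (Suc n) a b x * g x)"
        by (rule integral_restrict_space[symmetric]) (use sets\<Omega> in auto)
      also have "\<dots> = 0" by (rule 0[OF bump_in_test_functions[OF ab]])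
      finally show ?thesis .
    qed
    ultimately have "(LINT x|lebesgue. indicator (box a b) x * G x) = 0"
      by (simp add: LIMSEQ_const_iff)
    moreover have "indicator (box a b) x * G x = indicator (box a b) x *\<^sub>R g x" for x
      using box_subset_cbox[of a b] by (auto simp: G_def indicator_def)
    ultimately show ?thesis by (simp add: set_lebesgue_integral_def)
  qed
  obtain \<D> where \<D>: "countable \<D>" "\<D> \<subseteq> Pow \<Omega>" "\<And>X. X \<in> \<D> \<Longrightarrow> \<exists>a b. X = cbox a b" "\<Union>\<D> = \<Omega>"
    using open_countable_Union_open_cbox[OF \<Omega>] by metis
  have "AE x in lebesgue. x \<in> X \<longrightarrow> g x = 0" if X: "X \<in> \<D>" for X
  proof -
    obtain a b where ab: "X = cbox a b" using \<D>(3)[OF X] by blast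
    have sub: "cbox a b \<subseteq> \<Omega>" using X ab \<D>(2) by auto
    have "set_integrable lebesgue (box a b) g"
      by (rule set_integrable_subset[where A="cbox a b"])
        (use g sub box_subset_cbox[of a b] in \<open>auto simp: locally_L1_def sets_completionI_sets\<close>)
    moreover have "(LINT x:box a' b'|lebesgue. g x) = 0" if "box a' b' \<subseteq> box a b" for a' b'
    proof (cases "box a' b' = {}")
      case False
      then have "cbox a' b' \<subseteq> cbox a b"
        using closure_mono[OF that] that by (metis closure_box subset_empty)
      then have "cbox a' b' \<subseteq> \<Omega>" using sub by blast
      then show ?thesis by (rule box0)
    qed (simp add: set_lebesgue_integral_def)
    ultimately have "AE x in lebesgue. x \<in> box a b \<longrightarrow> g x = 0"
      by (rule integral_box_eq_0_imp_AE_eq_0)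
    \<comment> \<open>What is known so far concerns the open box; its boundary is a null set.\<close>
    moreover have "AE x in lebesgue. x \<notin> cbox a b - box a b"
      using negligible_frontier_interval[of a b] unfolding negligible_iff_null_sets by (rule AE_not_in)
    ultimately show ?thesis unfolding ab by eventually_elim auto
  qed
  then have "AE x in lebesgue. \<forall>X\<in>\<D>. x \<in> X \<longrightarrow> g x = 0"
    unfolding AE_ball_countable[OF \<D>(1)] by blast
  then have "AE x in lebesgue. x \<in> \<Omega> \<longrightarrow> g x = 0"
    by eventually_elim (use \<D>(4) in auto)
  then show ?thesis
    by (subst AE_restrict_space_iff) (use sets\<Omega> in auto)
qed

lemma fundamental_lemma_calculus_of_variations:
  fixes g :: "real ^ 'd \<Rightarrow> 'b::euclidean_space"
  assumes \<Omega>: "open \<Omega>" and g: "g \<in> locally_L1 \<Omega>"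
    and 0: "\<And>\<phi>. \<phi> \<in> test_functions \<Omega> \<Longrightarrow> (LINT x|lebesgue_on \<Omega>. \<phi> x *\<^sub>R g x) = 0"
  shows "AE x in lebesgue_on \<Omega>. g x = 0"
proof -
  have "AE x in lebesgue_on \<Omega>. g x \<bullet> i = 0" for i
  proof (rule fundamental_lemma_calculus_of_variations_real[OF \<Omega>])
    show "(\<lambda>x. g x \<bullet> i) \<in> locally_L1 \<Omega>"
      using g integrable_inner_left[where c=i] unfolding locally_L1_def set_integrable_def
      by fastforce
    fix \<phi> assume \<phi>: "\<phi> \<in> test_functions \<Omega>"
    have "integrable (lebesgue_on \<Omega>) (\<lambda>x. \<phi> x *\<^sub>R g x)"
      by (rule integrable_times_test_function[OF \<Omega> g \<phi>])
    then have "(LINT x|lebesgue_on \<Omega>. \<phi> x *\<^sub>R g x \<bullet> i) = (LINT x|lebesgue_on \<Omega>. \<phi> x *\<^sub>R g x) \<bullet> i"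
      by (simp only: integral_inner_left)
    then show "(LINT x|lebesgue_on \<Omega>. \<phi> x * (g x \<bullet> i)) = 0"
      using 0[OF \<phi>] by simp
  qed
  then have "AE x in lebesgue_on \<Omega>. \<forall>i\<in>Basis. g x \<bullet> i = 0"
    by (simp add: AE_ball_countable countable_finite)
  then show ?thesis by eventually_elim (simp add: euclidean_all_zero_iff)
qed

section \<open>Integration by parts for test functions\<close>

lemma has_real_derivative_along_axis:
  assumes "f differentiable (at (x + t *\<^sub>R axis i 1))"
  shows "((\<lambda>t. f (x + t *\<^sub>R axis i 1)) has_real_derivative partial_deriv i f (x + t *\<^sub>R axis i 1)) (at t)"
proof -
  let ?D = "frechet_derivative f (at (x + t *\<^sub>R axis i 1))"
  have D: "(f has_derivative ?D) (at (x + t *\<^sub>R axis i 1))"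
    using assms frechet_derivative_works by blast
  have "((\<lambda>t. f (x + t *\<^sub>R axis i 1)) has_derivative (\<lambda>s. ?D (s *\<^sub>R axis i 1))) (at t)"
    by (rule has_derivative_compose[where f="\<lambda>t. x + t *\<^sub>R axis i 1" and g=f, OF _ D]) (auto intro!: derivative_eq_intros)
  moreover have "?D (s *\<^sub>R axis i 1) = partial_deriv i f (x + t *\<^sub>R axis i 1) * s" for s
    using linear_cmul[OF has_derivative_linear[OF D], of s "axis i 1"] by (simp add: partial_deriv_def)
  ultimately show ?thesis by (simp add: has_field_derivative_def)
qed

lemma integrable_lborel_continuous_compact_support:
  fixes c :: "'a::euclidean_space \<Rightarrow> 'b::euclidean_space"
  assumes "compact K" "continuous_on UNIV c" "\<And>x. x \<notin> K \<Longrightarrow> c x = 0"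
  shows "integrable lborel c"
proof -
  have "integrable lborel (\<lambda>x. indicator K x *\<^sub>R c x)"
    by (rule borel_integrable_compact) (use assms continuous_on_subset in blast)+
  also have "(\<lambda>x. indicator K x *\<^sub>R c x) = c"
    using assms(3) by (auto simp: indicator_def fun_eq_iff)
  finally show ?thesis .
qed

lemma bounded_continuous_compact_support:
  fixes c :: "'a::euclidean_space \<Rightarrow> real"
  assumes "compact K" "continuous_on UNIV c" "\<And>x. x \<notin> K \<Longrightarrow> c x = 0"
  shows "\<exists>B\<ge>0. \<forall>x. \<bar>c x\<bar> \<le> B"
proof -
  have "bounded (c ` K)"
    using assms by (meson compact_continuous_image compact_imp_bounded continuous_on_subset subset_UNIV)
  then obtain B where B: "\<And>x. x \<in> K \<Longrightarrow> \<bar>c x\<bar> \<le> B"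
    by (auto simp: bounded_iff)
  \<comment> \<open>If \<open>K\<close> is empty, then \<open>B\<close> may be negative.\<close>
  have "\<bar>c x\<bar> \<le> max B 0" for x
    by (cases "x \<in> K") (use B assms(3) in force)+
  then show ?thesis by (intro exI[of _ "max B 0"]) auto
qed

text \<open>
  The difference quotients in direction \<open>i\<close> have integral zero because Lebesgue measure is translation
  invariant. They converge to the partial derivative, and by the mean value theorem they are dominated
  by the bound of the partial derivative on a large ball.
\<close>

lemma integral_partial_deriv_eq_0:
  fixes f :: "real ^ 'd \<Rightarrow> real"
  assumes K: "compact K" "\<And>x. x \<notin> K \<Longrightarrow> f x = 0"
    and diff: "\<And>x. f differentiable (at x)"
    and cont: "continuous_on UNIV (partial_deriv i f)"
  shows "(LINT x|lborel. partial_deriv i f x) = 0"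
proof -
  let ?e = "axis i 1 :: real ^ 'd"
  define t where "t n = inverse (real (Suc n))" for n
  have t: "0 < t n" "t n \<le> 1" for n by (auto simp: t_def field_simps)
  define q where "q n x = (f (x + t n *\<^sub>R ?e) - f x) / t n" for n x
  have contf: "continuous_on UNIV f"
    using diff by (auto intro: differentiable_imp_continuous_on simp: differentiable_on_def differentiable_at_withinI)
  have f: "integrable lborel f"
    by (rule integrable_lborel_continuous_compact_support[OF K(1) contf K(2)])
  have shift: "integrable lborel (\<lambda>x. f (x + v))" "(LINT x|lborel. f (x + v)) = (LINT x|lborel. f x)" for v
  proof -
    have *: "f \<in> borel_measurable lborel" using f by auto
    show "integrable lborel (\<lambda>x. f (x + v))"
      using f integrable_distr_eq[of "(+) v" lborel borel f] * by (simp add: lborel_distr_plus add.commute)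
    show "(LINT x|lborel. f (x + v)) = (LINT x|lborel. f x)"
      using integral_distr[of "(+) v" lborel borel f] * by (simp add: lborel_distr_plus add.commute)
  qed
  have q0: "(LINT x|lborel. q n x) = 0" for n
    unfolding q_def using shift f by simp
  obtain B where B: "B \<ge> 0" "\<And>x. \<bar>partial_deriv i f x\<bar> \<le> B"
    using bounded_continuous_compact_support[OF K(1) cont
      partial_deriv_eq_0_outside[OF compact_imp_closed[OF K(1)] K(2)]] by blast
  obtain R where R: "\<And>x. x \<in> K \<Longrightarrow> norm x \<le> R"
    using compact_imp_bounded[OF K(1)] by (auto simp: bounded_iff)
  \<comment> \<open>The step sizes are at most 1, so the difference quotients vanish outside \<open>cball 0 (R + 1)\<close>.\<close>
  have "(\<lambda>n. LINT x|lborel. q n x) \<longlonglongrightarrow> (LINT x|lborel. partial_deriv i f x)"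
  proof (rule integral_dominated_convergence[where w="\<lambda>x. indicator (cball 0 (R + 1)) x *\<^sub>R B"])
    show "partial_deriv i f \<in> borel_measurable lborel"
      using cont by (simp add: borel_measurable_continuous_onI)
    show "q n \<in> borel_measurable lborel" for n
      unfolding q_def using borel_measurable_integrable[OF shift(1)] borel_measurable_integrable[OF f]
      by (intro borel_measurable_divide borel_measurable_diff) auto
    show "integrable lborel (\<lambda>x. indicator (cball 0 (R + 1)) x *\<^sub>R B :: real)"
      by (rule borel_integrable_compact) auto
    show "AE x in lborel. (\<lambda>n. q n x) \<longlonglongrightarrow> partial_deriv i f x"
    proof (rule AE_I2)
      fix x
      have "((\<lambda>h. (f (x + h *\<^sub>R ?e) - f x) / h) \<longlongrightarrow> partial_deriv i f x) (at 0)"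
        using has_real_derivative_along_axis[OF diff, where x=x and t=0 and i=i] by (simp add: DERIV_def)
      moreover have "filterlim t (at 0) sequentially"
        using LIMSEQ_inverse_real_of_nat t(1) unfolding t_def[abs_def]
        by (auto simp: filterlim_at intro!: always_eventually)
      ultimately show "(\<lambda>n. q n x) \<longlonglongrightarrow> partial_deriv i f x"
        unfolding q_def by (rule filterlim_compose)
    qed
    show "AE x in lborel. norm (q n x) \<le> indicator (cball 0 (R + 1)) x *\<^sub>R B" for n
    proof (rule AE_I2)
      fix x
      show "norm (q n x) \<le> indicator (cball 0 (R + 1)) x *\<^sub>R B"
      proof (cases "x \<in> cball 0 (R + 1)")
        case True
        have "\<exists>z. 0 < z \<and> z < t n \<and>
            f (x + t n *\<^sub>R ?e) - f (x + 0 *\<^sub>R ?e) = (t n - 0) * partial_deriv i f (x + z *\<^sub>R ?e)"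
          by (rule MVT2[where f="\<lambda>s. f (x + s *\<^sub>R ?e)" and f'="\<lambda>s. partial_deriv i f (x + s *\<^sub>R ?e)"])
            (use t in \<open>auto intro: has_real_derivative_along_axis[OF diff]\<close>)
        then obtain z where "f (x + t n *\<^sub>R ?e) - f x = t n * partial_deriv i f (x + z *\<^sub>R ?e)"
          by auto
        then have "q n x = partial_deriv i f (x + z *\<^sub>R ?e)"
          using t(1)[of n] by (simp add: q_def)
        then show ?thesis using B True by simp
      next
        case False
        then have "norm x > R + 1" by simp
        moreover have "norm x \<le> norm (x + t n *\<^sub>R ?e) + 1"
          using norm_triangle_ineq4[of "x + t n *\<^sub>R ?e" "t n *\<^sub>R ?e"] t[of n] by simp
        ultimately have "x \<notin> K" "x + t n *\<^sub>R ?e \<notin> K" using R by fastforce+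
        then show ?thesis using K(2) B(1) by (simp add: q_def)
      qed
    qed
  qed
  then show ?thesis using q0 by (simp add: LIMSEQ_const_iff)
qed

lemma integral_lebesgue_on_eq_lborel:
  fixes c :: "'a::euclidean_space \<Rightarrow> 'b::euclidean_space"
  assumes "open \<Omega>" "continuous_on UNIV c" "\<And>x. x \<notin> \<Omega> \<Longrightarrow> c x = 0"
  shows "(LINT x|lebesgue_on \<Omega>. c x) = (LINT x|lborel. c x)"
proof -
  have "(LINT x|lebesgue_on \<Omega>. c x) = (LINT x|lebesgue. indicator \<Omega> x *\<^sub>R c x)"
    by (rule integral_restrict_space) (use assms(1) in auto)
  also have "\<dots> = (LINT x|lebesgue. c x)"
    by (intro Bochner_Integration.integral_cong refl) (use assms(3) in \<open>auto simp: indicator_def\<close>)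
  also have "\<dots> = (LINT x|lborel. c x)"
    by (rule integral_completion) (use assms(2) in \<open>simp add: borel_measurable_continuous_onI\<close>)
  finally show ?thesis .
qed

text \<open>
  The partial derivative of the product \<open>\<phi> \<psi>\<close>, which has compact support, integrates to zero.
\<close>

lemma integration_by_parts_partial_deriv:
  fixes \<phi> \<psi> :: "real ^ 'd \<Rightarrow> real"
  assumes \<Omega>: "open \<Omega>" and \<phi>: "\<phi> \<in> test_functions \<Omega>" and \<psi>: "\<psi> \<in> test_functions \<Omega>"
  shows "(LINT x|lebesgue_on \<Omega>. \<phi> x * partial_deriv i \<psi> x)
       = - (LINT x|lebesgue_on \<Omega>. partial_deriv i \<phi> x * \<psi> x)"
proof -
  obtain K where K: "compact K" "K \<subseteq> \<Omega>" "\<And>x. x \<notin> K \<Longrightarrow> \<phi> x = 0" "\<And>x. x \<notin> K \<Longrightarrow> classical_grad \<phi> x = 0"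
    using test_function_support[OF \<phi>] by metis
  have pd0: "partial_deriv i \<phi> x = 0" if "x \<notin> K" for x
    using K(4)[OF that] by (simp add: classical_grad_def vec_eq_iff)
  have diff: "\<phi> differentiable (at x)" "\<psi> differentiable (at x)" for x
    using test_function_differentiable \<phi> \<psi> by blast+
  have cont: "continuous_on UNIV \<phi>" "continuous_on UNIV \<psi>"
    "continuous_on UNIV (partial_deriv i \<phi>)" "continuous_on UNIV (partial_deriv i \<psi>)"
    using \<phi> \<psi> test_function_partial_deriv test_function_continuous by blast+
  have eq: "partial_deriv i (\<lambda>x. \<phi> x * \<psi> x) = (\<lambda>x. \<phi> x * partial_deriv i \<psi> x + partial_deriv i \<phi> x * \<psi> x)"
    by (rule ext) (rule partial_deriv_mult[OF diff])
  have "(LINT x|lborel. \<phi> x * partial_deriv i \<psi> x + partial_deriv i \<phi> x * \<psi> x) = 0"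
    unfolding eq[symmetric]
  proof (rule integral_partial_deriv_eq_0[OF K(1)])
    show "continuous_on UNIV (partial_deriv i (\<lambda>x. \<phi> x * \<psi> x))"
      unfolding eq by (intro continuous_intros cont)
  qed (use K(3) diff in auto)
  moreover have "integrable lborel (\<lambda>x. \<phi> x * partial_deriv i \<psi> x)" "integrable lborel (\<lambda>x. partial_deriv i \<phi> x * \<psi> x)"
    by (rule integrable_lborel_continuous_compact_support[OF K(1)]; use K(3) pd0 in \<open>auto intro!: continuous_intros cont\<close>)+
  moreover have "(LINT x|lebesgue_on \<Omega>. \<phi> x * partial_deriv i \<psi> x) = (LINT x|lborel. \<phi> x * partial_deriv i \<psi> x)"
    by (rule integral_lebesgue_on_eq_lborel[OF \<Omega>]) (use K(2,3) in \<open>auto intro!: continuous_intros cont\<close>)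
  moreover have "(LINT x|lebesgue_on \<Omega>. partial_deriv i \<phi> x * \<psi> x) = (LINT x|lborel. partial_deriv i \<phi> x * \<psi> x)"
    by (rule integral_lebesgue_on_eq_lborel[OF \<Omega>]) (use K(2) pd0 in \<open>auto intro!: continuous_intros cont\<close>)
  ultimately show ?thesis by simp
qed

lemma continuous_in_locally_L1:
  assumes "continuous_on UNIV c"
  shows "c \<in> locally_L1 \<Omega>"
  unfolding locally_L1_def set_integrable_def
proof (clarify)
  fix K :: "(real^'a) set" assume K: "compact K"
  have i: "integrable lborel (\<lambda>x. indicator K x *\<^sub>R c x)"
    by (rule borel_integrable_compact[OF K]) (use assms in \<open>auto intro: continuous_on_subset\<close>)
  then show "integrable lebesgue (\<lambda>x. indicator K x *\<^sub>R c x)"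
    by (subst integrable_completion) auto
qed

text \<open>
  Integration by parts in each coordinate.
\<close>

lemma has_weak_grad_test_function:
  assumes \<Omega>: "open \<Omega>" and \<psi>: "\<psi> \<in> test_functions \<Omega>"
  shows "has_weak_grad \<Omega> \<psi> (classical_grad \<psi>)"
  unfolding has_weak_grad_def
proof (intro conjI ballI)
  show L: "\<psi> \<in> locally_L1 \<Omega>" "classical_grad \<psi> \<in> locally_L1 \<Omega>"
    by (intro continuous_in_locally_L1 test_function_continuous[OF \<psi>] continuous_classical_grad[OF \<psi>])+
  fix \<phi> assume \<phi>: "\<phi> \<in> test_functions \<Omega>"
  have i: "integrable (lebesgue_on \<Omega>) (\<lambda>x. \<psi> x *\<^sub>R classical_grad \<phi> x)"
    "integrable (lebesgue_on \<Omega>) (\<lambda>x. \<phi> x *\<^sub>R classical_grad \<psi> x)"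
    by (rule integrable_times_grad_test_function[OF bilinear_scaleR \<Omega> L(1) \<phi>],
        rule integrable_times_test_function[OF \<Omega> L(2) \<phi>])
  show "(LINT x|lebesgue_on \<Omega>. \<psi> x *\<^sub>R classical_grad \<phi> x) = - (LINT x|lebesgue_on \<Omega>. \<phi> x *\<^sub>R classical_grad \<psi> x)"
  proof (subst vec_eq_iff, rule)
    fix j
    have "(LINT x|lebesgue_on \<Omega>. \<psi> x *\<^sub>R classical_grad \<phi> x) $ j = (LINT x|lebesgue_on \<Omega>. \<psi> x * partial_deriv j \<phi> x)"
      using integral_bounded_linear[OF bounded_linear_vec_nth i(1), of j] by (simp add: classical_grad_def)
    also have "\<dots> = - (LINT x|lebesgue_on \<Omega>. \<phi> x * partial_deriv j \<psi> x)"
      using integration_by_parts_partial_deriv[OF \<Omega> \<psi> \<phi>] by (simp add: mult.commute)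
    also have "\<dots> = (- (LINT x|lebesgue_on \<Omega>. \<phi> x *\<^sub>R classical_grad \<psi> x)) $ j"
      using integral_bounded_linear[OF bounded_linear_vec_nth i(2), of j] by (simp add: classical_grad_def)
    finally show "(LINT x|lebesgue_on \<Omega>. \<psi> x *\<^sub>R classical_grad \<phi> x) $ j
        = (- (LINT x|lebesgue_on \<Omega>. \<phi> x *\<^sub>R classical_grad \<psi> x)) $ j" .
  qed
qed

section \<open>Linearity and uniqueness of weak derivatives\<close>

text \<open>
  A common form of \<open>has_weak_grad\<close> and \<open>has_weak_div\<close>, which are the cases of \<open>h\<close> being scalar
  multiplication and inner product, so that linearity and uniqueness need only one proof each.
\<close>

definition weak_derivative ::
  "('b::euclidean_space \<Rightarrow> real ^ 'd \<Rightarrow> 'c::euclidean_space) \<Rightarrow> (real ^ 'd) set \<Rightarrow>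
    (real ^ 'd \<Rightarrow> 'b) \<Rightarrow> (real ^ 'd \<Rightarrow> 'c) \<Rightarrow> bool" where
  "weak_derivative h \<Omega> a b \<longleftrightarrow> a \<in> locally_L1 \<Omega> \<and> b \<in> locally_L1 \<Omega> \<and>
     (\<forall>\<phi> \<in> test_functions \<Omega>. (LINT x|lebesgue_on \<Omega>. h (a x) (classical_grad \<phi> x)) =
        - (LINT x|lebesgue_on \<Omega>. \<phi> x *\<^sub>R b x))"

lemma has_weak_grad_iff: "has_weak_grad \<Omega> u g \<longleftrightarrow> weak_derivative scaleR \<Omega> u g"
  by (simp add: has_weak_grad_def weak_derivative_def)

lemma has_weak_div_iff: "has_weak_div \<Omega> \<psi> q \<longleftrightarrow> weak_derivative inner \<Omega> \<psi> q"
  by (simp add: has_weak_div_def weak_derivative_def)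

lemma locally_L1_diff:
  assumes "a \<in> locally_L1 \<Omega>" "b \<in> locally_L1 \<Omega>"
  shows "(\<lambda>x. a x - b x) \<in> locally_L1 \<Omega>"
  using assms by (auto simp: locally_L1_def intro: set_integral_diff(1))

lemma weak_derivative_diff:
  assumes h: "bilinear h" and \<Omega>: "open \<Omega>"
    and 1: "weak_derivative h \<Omega> a b" and 2: "weak_derivative h \<Omega> a' b'"
  shows "weak_derivative h \<Omega> (\<lambda>x. a x - a' x) (\<lambda>x. b x - b' x)"
proof -
  have L: "a \<in> locally_L1 \<Omega>" "b \<in> locally_L1 \<Omega>" "a' \<in> locally_L1 \<Omega>" "b' \<in> locally_L1 \<Omega>"
    using 1 2 by (auto simp: weak_derivative_def)
  have "(LINT x|lebesgue_on \<Omega>. h (a x - a' x) (classical_grad \<phi> x)) =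
        - (LINT x|lebesgue_on \<Omega>. \<phi> x *\<^sub>R (b x - b' x))" if \<phi>: "\<phi> \<in> test_functions \<Omega>" for \<phi>
  proof -
    have "(LINT x|lebesgue_on \<Omega>. h (a x - a' x) (classical_grad \<phi> x))
        = (LINT x|lebesgue_on \<Omega>. h (a x) (classical_grad \<phi> x)) - (LINT x|lebesgue_on \<Omega>. h (a' x) (classical_grad \<phi> x))"
      unfolding bilinear_lsub[OF h]
      by (intro Bochner_Integration.integral_diff integrable_times_grad_test_function[OF h \<Omega> _ \<phi>] L)
    also have "\<dots> = - ((LINT x|lebesgue_on \<Omega>. \<phi> x *\<^sub>R b x) - (LINT x|lebesgue_on \<Omega>. \<phi> x *\<^sub>R b' x))"
      using 1 2 \<phi> by (simp add: weak_derivative_def)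
    also have "\<dots> = - (LINT x|lebesgue_on \<Omega>. \<phi> x *\<^sub>R (b x - b' x))"
      unfolding scaleR_diff_right
      by (subst Bochner_Integration.integral_diff) (use integrable_times_test_function[OF \<Omega> _ \<phi>] L in auto)
    finally show ?thesis .
  qed
  then show ?thesis
    using L by (auto simp: weak_derivative_def intro: locally_L1_diff)
qed

text \<open>
  By linearity the difference of two weak derivatives of \<open>a\<close> is a weak derivative of zero, hence is
  orthogonal to all test functions.
\<close>

lemma weak_derivative_unique:
  assumes h: "bilinear h" and \<Omega>: "open \<Omega>"
    and 1: "weak_derivative h \<Omega> a b" and 2: "weak_derivative h \<Omega> a b'"
  shows "AE x in lebesgue_on \<Omega>. b x = b' x"
proof -
  have D: "weak_derivative h \<Omega> (\<lambda>x. 0) (\<lambda>x. b x - b' x)"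
    using weak_derivative_diff[OF h \<Omega> 1 2] by simp
  have "AE x in lebesgue_on \<Omega>. b x - b' x = 0"
  proof (rule fundamental_lemma_calculus_of_variations[OF \<Omega>])
    show "(\<lambda>x. b x - b' x) \<in> locally_L1 \<Omega>"
      using D by (simp add: weak_derivative_def)
    show "(LINT x|lebesgue_on \<Omega>. \<phi> x *\<^sub>R (b x - b' x)) = 0" if "\<phi> \<in> test_functions \<Omega>" for \<phi>
      using D that by (simp add: weak_derivative_def bilinear_lzero[OF h])
  qed
  then show ?thesis by eventually_elim simp
qed

lemma has_weak_grad_unique:
  assumes "open \<Omega>" "has_weak_grad \<Omega> u g" "has_weak_grad \<Omega> u g'"
  shows "AE x in lebesgue_on \<Omega>. g x = g' x"
  using weak_derivative_unique[OF bilinear_scaleR] assms unfolding has_weak_grad_iff by blast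

lemma has_weak_div_unique:
  assumes "open \<Omega>" "has_weak_div \<Omega> \<psi> q" "has_weak_div \<Omega> \<psi> q'"
  shows "AE x in lebesgue_on \<Omega>. q x = q' x"
  using weak_derivative_unique[OF bilinear_inner] assms unfolding has_weak_div_iff by blast

lemma weak_grad_AE:
  assumes "open \<Omega>" "has_weak_grad \<Omega> u g"
  shows "AE x in lebesgue_on \<Omega>. weak_grad \<Omega> u x = g x"
  by (rule has_weak_grad_unique[OF assms(1) _ assms(2)])
    (use someI[of "has_weak_grad \<Omega> u", OF assms(2)] in \<open>simp add: weak_grad_def\<close>)

lemma weak_div_AE:
  assumes "open \<Omega>" "has_weak_div \<Omega> \<psi> q"
  shows "AE x in lebesgue_on \<Omega>. weak_div \<Omega> \<psi> x = q x"
  by (rule has_weak_div_unique[OF assms(1) _ assms(2)])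
    (use someI[of "has_weak_div \<Omega> \<psi>", OF assms(2)] in \<open>simp add: weak_div_def\<close>)

section \<open>Square integrable functions\<close>

text \<open>
  Measurability passes to functions that agree almost everywhere because Lebesgue measure is
  complete.
\<close>

lemma borel_measurable_lebesgue_on_AE:
  fixes f g :: "'a::euclidean_space \<Rightarrow> 'b::euclidean_space"
  assumes S: "S \<in> sets lebesgue" and f: "f \<in> borel_measurable (lebesgue_on S)"
    and ae: "AE x in lebesgue_on S. f x = g x"
  shows "g \<in> borel_measurable (lebesgue_on S)"
proof -
  have S': "S \<inter> space lebesgue \<in> sets lebesgue" using S by simp
  have "(\<lambda>x. indicator S x *\<^sub>R f x) \<in> borel_measurable lebesgue"
    using f borel_measurable_restrict_space_iff[OF S', of f] by (simp add: mult.commute)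
  moreover have "AE x in lebesgue. indicator S x *\<^sub>R f x = indicator S x *\<^sub>R g x"
    using ae unfolding AE_restrict_space_iff[OF S'] by eventually_elim (auto simp: indicator_def)
  ultimately have "(\<lambda>x. indicator S x *\<^sub>R g x) \<in> borel_measurable lebesgue"
    by (rule borel_measurable_AE)
  then show ?thesis
    using borel_measurable_restrict_space_iff[OF S', of g] by (simp add: mult.commute)
qed

lemma L2_AE:
  assumes "open \<Omega>" "f \<in> L2 \<Omega>" "AE x in lebesgue_on \<Omega>. f x = g x"
  shows "g \<in> L2 \<Omega>"
proof -
  have \<Omega>: "\<Omega> \<in> sets lebesgue" using assms(1) by (simp add: sets_completionI_sets)
  have f: "f \<in> borel_measurable (lebesgue_on \<Omega>)" "integrable (lebesgue_on \<Omega>) (\<lambda>x. (norm (f x))\<^sup>2)"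
    using assms(2) by (auto simp: L2_def)
  have g: "g \<in> borel_measurable (lebesgue_on \<Omega>)"
    by (rule borel_measurable_lebesgue_on_AE[OF \<Omega> f(1) assms(3)])
  have "integrable (lebesgue_on \<Omega>) (\<lambda>x. (norm (g x))\<^sup>2)"
  proof (rule integrable_cong_AE_imp[OF f(2)])
    show "(\<lambda>x. (norm (g x))\<^sup>2) \<in> borel_measurable (lebesgue_on \<Omega>)" using g by measurable
    show "AE x in lebesgue_on \<Omega>. (norm (f x))\<^sup>2 = (norm (g x))\<^sup>2"
      using assms(3) by eventually_elim simp
  qed
  then show ?thesis using g by (simp add: L2_def)
qed

lemma L2_integrable_norm: "f \<in> L2 \<Omega> \<Longrightarrow> integrable (lebesgue_on \<Omega>) (\<lambda>x. (norm (f x))\<^sup>2)"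
  by (simp add: L2_def)

lemma L2_norm_squared: "(L2_norm \<Omega> f)\<^sup>2 = (LINT x|lebesgue_on \<Omega>. (norm (f x))\<^sup>2)"
  by (simp add: L2_norm_def)

lemma L2_integrable_inner:
  assumes "f \<in> L2 \<Omega>" "g \<in> L2 \<Omega>"
  shows "integrable (lebesgue_on \<Omega>) (\<lambda>x. f x \<bullet> g x)"
proof (rule Bochner_Integration.integrable_bound)
  show "integrable (lebesgue_on \<Omega>) (\<lambda>x. (norm (f x))\<^sup>2 + (norm (g x))\<^sup>2)"
    using assms by (auto simp: L2_def)
  show "(\<lambda>x. f x \<bullet> g x) \<in> borel_measurable (lebesgue_on \<Omega>)"
    using assms by (auto simp: L2_def)
  show "AE x in lebesgue_on \<Omega>. norm (f x \<bullet> g x) \<le> norm ((norm (f x))\<^sup>2 + (norm (g x))\<^sup>2)"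
  proof (rule AE_I2)
    fix x
    have "\<bar>f x \<bullet> g x\<bar> \<le> norm (f x) * norm (g x)" by (rule Cauchy_Schwarz_ineq2)
    also have "\<dots> \<le> (norm (f x))\<^sup>2 + (norm (g x))\<^sup>2"
      using sum_squares_bound[of "norm (f x)" "norm (g x)"]
        mult_nonneg_nonneg[OF norm_ge_zero[of "f x"] norm_ge_zero[of "g x"]] by linarith
    finally show "norm (f x \<bullet> g x) \<le> norm ((norm (f x))\<^sup>2 + (norm (g x))\<^sup>2)" by simp
  qed
qed

lemma power2_norm_diff: "(norm (v - w))\<^sup>2 = (norm v)\<^sup>2 - 2 * (v \<bullet> w) + (norm (w :: 'a :: real_inner))\<^sup>2"
  by (simp add: power2_norm_eq_inner inner_diff_left inner_diff_right inner_commute)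

lemma L2_diff:
  assumes "f \<in> L2 \<Omega>" "g \<in> L2 \<Omega>"
  shows "(\<lambda>x. f x - g x) \<in> L2 \<Omega>"
  using assms L2_integrable_inner[OF assms] by (auto simp: L2_def power2_norm_diff)

lemma L2_norm_diff:
  assumes "f \<in> L2 \<Omega>" "g \<in> L2 \<Omega>"
  shows "(L2_norm \<Omega> (\<lambda>x. f x - g x))\<^sup>2
    = (L2_norm \<Omega> f)\<^sup>2 - 2 * (LINT x|lebesgue_on \<Omega>. f x \<bullet> g x) + (L2_norm \<Omega> g)\<^sup>2"
  unfolding L2_norm_squared power2_norm_diff
  using L2_integrable_inner[OF assms] assms[THEN L2_integrable_norm] by simp

lemma L2_norm_AE:
  assumes "f \<in> L2 \<Omega>" "g \<in> L2 \<Omega>" "AE x in lebesgue_on \<Omega>. f x = g x"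
  shows "L2_norm \<Omega> f = L2_norm \<Omega> g"
proof -
  have "(LINT x|lebesgue_on \<Omega>. (norm (f x))\<^sup>2) = (LINT x|lebesgue_on \<Omega>. (norm (g x))\<^sup>2)"
  proof (rule integral_cong_AE)
    show "AE x in lebesgue_on \<Omega>. (norm (f x))\<^sup>2 = (norm (g x))\<^sup>2"
      using assms(3) by eventually_elim simp
  qed (use assms(1,2)[THEN L2_integrable_norm] in auto)
  then show ?thesis by (simp add: L2_norm_def)
qed

lemma test_function_L2:
  assumes \<Omega>: "open \<Omega>" and \<phi>: "\<phi> \<in> test_functions \<Omega>"
  shows "\<phi> \<in> L2 \<Omega>" "classical_grad \<phi> \<in> L2 \<Omega>"
proof -
  have L: "\<phi> \<in> locally_L1 \<Omega>" "classical_grad \<phi> \<in> locally_L1 \<Omega>"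
    using has_weak_grad_test_function[OF assms] by (auto simp: has_weak_grad_def)
  have m: "c \<in> borel_measurable (lebesgue_on \<Omega>)" if "continuous_on UNIV c" for c :: "real^'a \<Rightarrow> 'b::euclidean_space"
    by (rule continuous_imp_measurable_on_sets_lebesgue)
      (use that continuous_on_subset \<Omega> in \<open>auto simp: sets_completionI_sets\<close>)
  show "\<phi> \<in> L2 \<Omega>"
    using integrable_times_test_function[OF \<Omega> L(1) \<phi>] m[OF test_function_continuous[OF \<phi>]]
    by (simp add: L2_def power2_eq_square)
  show "classical_grad \<phi> \<in> L2 \<Omega>"
    using integrable_times_grad_test_function[OF bilinear_inner \<Omega> L(2) \<phi>] m[OF continuous_classical_grad[OF \<phi>]]
    by (simp add: L2_def power2_norm_eq_inner)
qed

text \<open>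
  Young's inequality with a weight \<open>\<delta>\<close>; it follows from \<open>(norm v - \<delta> * norm w)\<^sup>2 \<ge> 0\<close>.
\<close>

lemma abs_inner_le_weighted:
  fixes v w :: "'a::real_inner"
  assumes "\<delta> > 0"
  shows "\<bar>v \<bullet> w\<bar> \<le> ((norm v)\<^sup>2 / \<delta> + \<delta> * (norm w)\<^sup>2) / 2"
proof -
  have "\<bar>v \<bullet> w\<bar> \<le> norm v * norm w" by (rule Cauchy_Schwarz_ineq2)
  moreover have "0 \<le> (norm v - \<delta> * norm w)\<^sup>2 / \<delta>" using assms by simp
  then have "2 * (norm v * norm w) \<le> (norm v)\<^sup>2 / \<delta> + \<delta> * (norm w)\<^sup>2"
    using assms by (simp add: field_simps power2_eq_square)
  ultimately have "2 * \<bar>v \<bullet> w\<bar> \<le> (norm v)\<^sup>2 / \<delta> + \<delta> * (norm w)\<^sup>2" by linarith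
  then show ?thesis by simp
qed

lemma abs_integral_inner_le:
  assumes f: "f \<in> L2 \<Omega>" and g: "g \<in> L2 \<Omega>" and \<delta>: "\<delta> > 0"
  shows "\<bar>LINT x|lebesgue_on \<Omega>. f x \<bullet> g x\<bar> \<le> ((L2_norm \<Omega> f)\<^sup>2 / \<delta> + \<delta> * (L2_norm \<Omega> g)\<^sup>2) / 2"
proof -
  have "\<bar>LINT x|lebesgue_on \<Omega>. f x \<bullet> g x\<bar> \<le> (LINT x|lebesgue_on \<Omega>. \<bar>f x \<bullet> g x\<bar>)"
    by (rule integral_abs_bound)
  also have "\<dots> \<le> (LINT x|lebesgue_on \<Omega>. ((norm (f x))\<^sup>2 / \<delta> + \<delta> * (norm (g x))\<^sup>2) / 2)"
    using f g by (intro integral_mono integrable_abs L2_integrable_inner abs_inner_le_weighted[OF \<delta>])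
      (auto simp: L2_def)
  also have "\<dots> = ((L2_norm \<Omega> f)\<^sup>2 / \<delta> + \<delta> * (L2_norm \<Omega> g)\<^sup>2) / 2"
    using f g by (simp add: L2_norm_squared L2_def)
  finally show ?thesis .
qed

section \<open>The spaces of functions with square integrable gradient or divergence\<close>

text \<open>
  The representative selected by \<open>weak_grad\<close> agrees almost everywhere with a square integrable one, so
  it is square integrable itself.
\<close>

lemma H1_weak_grad:
  assumes "open \<Omega>" "u \<in> H1 \<Omega>"
  shows "u \<in> L2 \<Omega>" "weak_grad \<Omega> u \<in> L2 \<Omega>" "has_weak_grad \<Omega> u (weak_grad \<Omega> u)"
proof -
  obtain g where g: "g \<in> L2 \<Omega>" "has_weak_grad \<Omega> u g" and u: "u \<in> L2 \<Omega>"
    using assms(2) by (auto simp: H1_def)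
  show "u \<in> L2 \<Omega>" by fact
  show "has_weak_grad \<Omega> u (weak_grad \<Omega> u)"
    unfolding weak_grad_def using someI[of "has_weak_grad \<Omega> u", OF g(2)] .
  have "AE x in lebesgue_on \<Omega>. g x = weak_grad \<Omega> u x"
    using weak_grad_AE[OF assms(1) g(2)] by eventually_elim simp
  then show "weak_grad \<Omega> u \<in> L2 \<Omega>" by (rule L2_AE[OF assms(1) g(1)])
qed

lemma D_weak_div:
  assumes "open \<Omega>" "\<psi> \<in> D \<Omega>"
  shows "\<psi> \<in> L2 \<Omega>" "weak_div \<Omega> \<psi> \<in> L2 \<Omega>" "has_weak_div \<Omega> \<psi> (weak_div \<Omega> \<psi>)"
proof -
  obtain q where q: "q \<in> L2 \<Omega>" "has_weak_div \<Omega> \<psi> q" and \<psi>: "\<psi> \<in> L2 \<Omega>"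
    using assms(2) by (auto simp: D_def)
  show "\<psi> \<in> L2 \<Omega>" by fact
  show "has_weak_div \<Omega> \<psi> (weak_div \<Omega> \<psi>)"
    unfolding weak_div_def using someI[of "has_weak_div \<Omega> \<psi>", OF q(2)] .
  have "AE x in lebesgue_on \<Omega>. q x = weak_div \<Omega> \<psi> x"
    using weak_div_AE[OF assms(1) q(2)] by eventually_elim simp
  then show "weak_div \<Omega> \<psi> \<in> L2 \<Omega>" by (rule L2_AE[OF assms(1) q(1)])
qed

lemma H1_diff:
  assumes \<Omega>: "open \<Omega>" and u: "u \<in> H1 \<Omega>" and v: "v \<in> H1 \<Omega>"
  shows "(\<lambda>x. u x - v x) \<in> H1 \<Omega>"
    "AE x in lebesgue_on \<Omega>. weak_grad \<Omega> (\<lambda>x. u x - v x) x = weak_grad \<Omega> u x - weak_grad \<Omega> v x"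
proof -
  note * = H1_weak_grad[OF \<Omega> u] H1_weak_grad[OF \<Omega> v]
  have g: "has_weak_grad \<Omega> (\<lambda>x. u x - v x) (\<lambda>x. weak_grad \<Omega> u x - weak_grad \<Omega> v x)"
    using weak_derivative_diff[OF bilinear_scaleR \<Omega>] *(3,6) unfolding has_weak_grad_iff by blast
  then show "AE x in lebesgue_on \<Omega>. weak_grad \<Omega> (\<lambda>x. u x - v x) x = weak_grad \<Omega> u x - weak_grad \<Omega> v x"
    by (rule weak_grad_AE[OF \<Omega>])
  show "(\<lambda>x. u x - v x) \<in> H1 \<Omega>"
    unfolding H1_def using g L2_diff[OF *(1,4)] L2_diff[OF *(2,5)] by blast
qed

lemma D_diff:
  assumes \<Omega>: "open \<Omega>" and p: "p \<in> D \<Omega>" and q: "q \<in> D \<Omega>"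
  shows "(\<lambda>x. p x - q x) \<in> D \<Omega>"
    "AE x in lebesgue_on \<Omega>. weak_div \<Omega> (\<lambda>x. p x - q x) x = weak_div \<Omega> p x - weak_div \<Omega> q x"
proof -
  note * = D_weak_div[OF \<Omega> p] D_weak_div[OF \<Omega> q]
  have g: "has_weak_div \<Omega> (\<lambda>x. p x - q x) (\<lambda>x. weak_div \<Omega> p x - weak_div \<Omega> q x)"
    using weak_derivative_diff[OF bilinear_inner \<Omega>] *(3,6) unfolding has_weak_div_iff by blast
  then show "AE x in lebesgue_on \<Omega>. weak_div \<Omega> (\<lambda>x. p x - q x) x = weak_div \<Omega> p x - weak_div \<Omega> q x"
    by (rule weak_div_AE[OF \<Omega>])
  show "(\<lambda>x. p x - q x) \<in> D \<Omega>"
    unfolding D_def using g L2_diff[OF *(1,4)] L2_diff[OF *(2,5)] by blast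
qed

lemma test_function_H1:
  assumes "open \<Omega>" "\<phi> \<in> test_functions \<Omega>"
  shows "\<phi> \<in> H1 \<Omega>"
  unfolding H1_def using test_function_L2[OF assms] has_weak_grad_test_function[OF assms] by blast

lemma H1_norm_squared: "(H1_norm \<Omega> u)\<^sup>2 = (L2_norm \<Omega> u)\<^sup>2 + (L2_norm \<Omega> (weak_grad \<Omega> u))\<^sup>2"
  by (simp add: H1_norm_def)

lemma D_norm_squared: "(D_norm \<Omega> \<psi>)\<^sup>2 = (L2_norm \<Omega> \<psi>)\<^sup>2 + (L2_norm \<Omega> (weak_div \<Omega> \<psi>))\<^sup>2"
  by (simp add: D_norm_def)

section \<open>Green's formula for zero boundary values\<close>

text \<open>
  The integral of the divergence of \<open>u q\<close>, in the form that is meaningful for weak derivatives.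
\<close>

definition green_form :: "(real ^ 'd) set \<Rightarrow> (real ^ 'd \<Rightarrow> real) \<Rightarrow> (real ^ 'd \<Rightarrow> real ^ 'd) \<Rightarrow> real" where
  "green_form \<Omega> u q = (LINT x|lebesgue_on \<Omega>. u x \<bullet> weak_div \<Omega> q x)
     + (LINT x|lebesgue_on \<Omega>. weak_grad \<Omega> u x \<bullet> q x)"

lemma green_form_diff:
  assumes \<Omega>: "open \<Omega>" and u: "u \<in> H1 \<Omega>" and v: "v \<in> H1 \<Omega>" and q: "q \<in> D \<Omega>"
  shows "green_form \<Omega> (\<lambda>x. u x - v x) q = green_form \<Omega> u q - green_form \<Omega> v q"
proof -
  note * = H1_weak_grad[OF \<Omega> u] H1_weak_grad[OF \<Omega> v] D_weak_div[OF \<Omega> q]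
  note d = H1_diff[OF \<Omega> u v]
  note i = L2_integrable_inner[OF *(1,8)] L2_integrable_inner[OF *(4,8)]
    L2_integrable_inner[OF *(2,7)] L2_integrable_inner[OF *(5,7)]
    L2_integrable_inner[OF H1_weak_grad(2)[OF \<Omega> d(1)] *(7)]
  have "(LINT x|lebesgue_on \<Omega>. weak_grad \<Omega> (\<lambda>x. u x - v x) x \<bullet> q x)
      = (LINT x|lebesgue_on \<Omega>. weak_grad \<Omega> u x \<bullet> q x - weak_grad \<Omega> v x \<bullet> q x)"
  proof (rule integral_cong_AE)
    show "AE x in lebesgue_on \<Omega>. weak_grad \<Omega> (\<lambda>x. u x - v x) x \<bullet> q x
        = weak_grad \<Omega> u x \<bullet> q x - weak_grad \<Omega> v x \<bullet> q x"
      using d(2) by eventually_elim (simp add: inner_diff_left)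
  qed (use i(3-5) in auto)
  then show ?thesis
    using i by (simp add: green_form_def inner_diff_left left_diff_distrib)
qed

text \<open>
  With the classical gradient in place of the weak one, this is the definition of the weak
  divergence.
\<close>

lemma green_form_test_function:
  assumes \<Omega>: "open \<Omega>" and \<phi>: "\<phi> \<in> test_functions \<Omega>" and q: "q \<in> D \<Omega>"
  shows "green_form \<Omega> \<phi> q = 0"
proof -
  note * = D_weak_div[OF \<Omega> q]
  have "(LINT x|lebesgue_on \<Omega>. weak_grad \<Omega> \<phi> x \<bullet> q x) = (LINT x|lebesgue_on \<Omega>. q x \<bullet> classical_grad \<phi> x)"
  proof (rule integral_cong_AE)
    show "AE x in lebesgue_on \<Omega>. weak_grad \<Omega> \<phi> x \<bullet> q x = q x \<bullet> classical_grad \<phi> x"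
      using weak_grad_AE[OF \<Omega> has_weak_grad_test_function[OF \<Omega> \<phi>]]
      by eventually_elim (simp add: inner_commute)
  qed (use L2_integrable_inner[OF H1_weak_grad(2)[OF \<Omega> test_function_H1[OF \<Omega> \<phi>]] *(1)]
      L2_integrable_inner[OF *(1) test_function_L2(2)[OF \<Omega> \<phi>]] in auto)
  then show ?thesis
    using *(3) \<phi> by (simp add: green_form_def has_weak_div_def)
qed

text \<open>
  The weight takes the place of the product of the two norms in the Cauchy-Schwarz inequality: with
  \<open>\<delta>\<close> of the size of \<open>H1_norm \<Omega> u\<close> the right-hand side is of the size of \<open>\<delta>\<close>.
\<close>

lemma abs_green_form_le:
  assumes \<Omega>: "open \<Omega>" and u: "u \<in> H1 \<Omega>" and q: "q \<in> D \<Omega>" and \<delta>: "\<delta> > 0"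
  shows "\<bar>green_form \<Omega> u q\<bar> \<le> ((H1_norm \<Omega> u)\<^sup>2 / \<delta> + \<delta> * (D_norm \<Omega> q)\<^sup>2) / 2"
proof -
  note * = H1_weak_grad[OF \<Omega> u] D_weak_div[OF \<Omega> q]
  show ?thesis
    using abs_integral_inner_le[OF *(1,5) \<delta>] abs_integral_inner_le[OF *(2,4) \<delta>]
    unfolding green_form_def H1_norm_squared D_norm_squared add_divide_distrib distrib_left by linarith
qed

text \<open>
  Subtracting a test function does not change the value of the form, but makes the first argument
  arbitrarily small in the \<open>H1\<close> norm.
\<close>

lemma green_form_H1_0_eq_0:
  assumes \<Omega>: "open \<Omega>" and u: "u \<in> H1_0 \<Omega>" and q: "q \<in> D \<Omega>"
  shows "green_form \<Omega> u q = 0"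
proof -
  have uH: "u \<in> H1 \<Omega>" using u by (simp add: H1_0_def)
  have bound: "\<bar>green_form \<Omega> u q\<bar> \<le> \<delta> * (1 + (D_norm \<Omega> q)\<^sup>2)" if \<delta>: "\<delta> > 0" for \<delta>
  proof -
    obtain \<phi> where \<phi>: "\<phi> \<in> test_functions \<Omega>" and lt: "H1_norm \<Omega> (\<lambda>x. u x - \<phi> x) < \<delta>"
      using u \<delta> by (auto simp: H1_0_def)
    note \<phi>H = test_function_H1[OF \<Omega> \<phi>]
    have "0 \<le> H1_norm \<Omega> (\<lambda>x. u x - \<phi> x)" by (simp add: H1_norm_def)
    then have "(H1_norm \<Omega> (\<lambda>x. u x - \<phi> x))\<^sup>2 / \<delta> \<le> \<delta>"
      using power_mono[of "H1_norm \<Omega> (\<lambda>x. u x - \<phi> x)" \<delta> 2] lt \<delta> by (simp add: divide_le_eq power2_eq_square)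
    moreover have "green_form \<Omega> u q = green_form \<Omega> (\<lambda>x. u x - \<phi> x) q"
      using green_form_diff[OF \<Omega> uH \<phi>H q] green_form_test_function[OF \<Omega> \<phi> q] by simp
    moreover have "0 \<le> \<delta> * (1 + (D_norm \<Omega> q)\<^sup>2)" using \<delta> by simp
    ultimately show ?thesis
      using abs_green_form_le[OF \<Omega> H1_diff(1)[OF \<Omega> uH \<phi>H] q \<delta>] by (simp add: distrib_left)
  qed
  have "\<bar>green_form \<Omega> u q\<bar> \<le> 0"
  proof (rule field_le_epsilon)
    fix e :: real assume "e > 0"
    moreover have "0 < 1 + (D_norm \<Omega> q)\<^sup>2" by (simp add: add_pos_nonneg)
    ultimately show "\<bar>green_form \<Omega> u q\<bar> \<le> 0 + e"
      using bound[of "e / (1 + (D_norm \<Omega> q)\<^sup>2)"] by simp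
  qed
  then show ?thesis by simp
qed

section \<open>The error identity\<close>

theorem theorem2p3:
  fixes \<Omega> :: "(real ^ 'd) set"
    and f u u' :: "real ^ 'd \<Rightarrow> real"
    and p p' :: "real ^ 'd \<Rightarrow> real ^ 'd"
  assumes "open \<Omega>" and "connected \<Omega>" and "\<Omega> \<noteq> {}"
    and "f \<in> L2 \<Omega>"
    and "u \<in> H1_0 \<Omega>" and "p \<in> D \<Omega>"
    and "reaction_diffusion \<Omega> f u p"
    and "u' \<in> H1_0 \<Omega>" and "p' \<in> D \<Omega>"
  shows "(H1_norm \<Omega> (\<lambda>x. u x - u' x))\<^sup>2 + (D_norm \<Omega> (\<lambda>x. p x - p' x))\<^sup>2 =
         (L2_norm \<Omega> (\<lambda>x. f x - u' x + weak_div \<Omega> p' x))\<^sup>2 +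
         (L2_norm \<Omega> (\<lambda>x. p' x - weak_grad \<Omega> u' x))\<^sup>2"
proof -
  note \<Omega> = \<open>open \<Omega>\<close>
  let ?e = "\<lambda>x. u x - u' x" and ?q = "\<lambda>x. p x - p' x"
  have H: "u \<in> H1 \<Omega>" "u' \<in> H1 \<Omega>" using assms by (auto simp: H1_0_def)
  note e = H1_diff[OF \<Omega> H] and q = D_diff[OF \<Omega> assms(6,9)]
  note eL = H1_weak_grad[OF \<Omega> e(1)] and qL = D_weak_div[OF \<Omega> q(1)]
  have eqs: "AE x in lebesgue_on \<Omega>. - weak_grad \<Omega> u x + p x = 0"
    "AE x in lebesgue_on \<Omega>. - weak_div \<Omega> p x + u x = f x"
    using assms(7) by (auto simp: reaction_diffusion_def)
  \<comment> \<open>Both residuals of the approximation are residuals of the error.\<close>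
  have "AE x in lebesgue_on \<Omega>. ?e x - weak_div \<Omega> ?q x = f x - u' x + weak_div \<Omega> p' x"
    using q(2) eqs(2) by eventually_elim simp
  moreover from this have "(\<lambda>x. f x - u' x + weak_div \<Omega> p' x) \<in> L2 \<Omega>"
    by (rule L2_AE[OF \<Omega> L2_diff[OF eL(1) qL(2)]])
  ultimately have 1: "L2_norm \<Omega> (\<lambda>x. f x - u' x + weak_div \<Omega> p' x) = L2_norm \<Omega> (\<lambda>x. ?e x - weak_div \<Omega> ?q x)"
    using L2_norm_AE[OF L2_diff[OF eL(1) qL(2)]] by simp
  have "AE x in lebesgue_on \<Omega>. weak_grad \<Omega> ?e x - ?q x = p' x - weak_grad \<Omega> u' x"
    using e(2) eqs(1) by eventually_elim (simp add: algebra_simps)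
  moreover from this have "(\<lambda>x. p' x - weak_grad \<Omega> u' x) \<in> L2 \<Omega>"
    by (rule L2_AE[OF \<Omega> L2_diff[OF eL(2) qL(1)]])
  ultimately have 2: "L2_norm \<Omega> (\<lambda>x. p' x - weak_grad \<Omega> u' x) = L2_norm \<Omega> (\<lambda>x. weak_grad \<Omega> ?e x - ?q x)"
    using L2_norm_AE[OF L2_diff[OF eL(2) qL(1)]] by simp
  \<comment> \<open>The cross terms of the two expanded squares add up to \<open>-2 * green_form \<Omega> ?e ?q\<close>.\<close>
  have "green_form \<Omega> ?e ?q = 0"
    using green_form_diff[OF \<Omega> H q(1)] green_form_H1_0_eq_0[OF \<Omega> _ q(1)] assms(5,8) by simp
  then show ?thesis
    unfolding 1 2 L2_norm_diff[OF eL(1) qL(2)] L2_norm_diff[OF eL(2) qL(1)] H1_norm_squared D_norm_squared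
    unfolding green_form_def by simp
qed

end
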